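(* Given any measure preserving system $(X,\mu,T)$ and any measurable set $A\subset X$, there exists some $E\subset \mathbb{N}$ such that \[ \mu\left( \bigcap_{i=1}^k T^{-n_i}A\right) = \lim_{N\to \infty} \frac{\left|\left( \bigcap_{i=1}^k (E-n_i) \right)\cap \{0,\dots,N-1\}\right|}{N}\] for any $k,n_1,\dots,n_k \in \mathbb{N}$ (in particular, all of these limits exist).
   Context: $\mathbb{N}=\{0,1,2,\dots\}$. A measure preserving system $(X,\mu,T)$ consists of a probability space $(X,\mu)$ (the $\sigma$-algebra is suppressed from the notation) and a measurable map $T:X\to X$ with $\mu(T^{-1}B)=\mu(B)$ for all measurable $B\subset X$; $T$ is not assumed invertible and the system is not assumed ergodic. For $E\subset\mathbb{N}$ and $n\in\mathbb{N}$, $E-n:=\{m\in\mathbb{N} : m+n\in E\}$. An empty intersection ($k=0$) is read as $X$ on the left and $\mathbb{N}$ on the right. *)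

theory Defs
  imports "HOL-Probability.Probability"
begin

locale measure_preserving_system = prob_space M for M :: "'a measure" +
  fixes T :: "'a \<Rightarrow> 'a"
  assumes measurable_T: "T \<in> measurable M M"
    and measure_vimage: "\<And>B. B \<in> sets M \<Longrightarrow> measure M (T -` B \<inter> space M) = measure M B"

definition shift_back :: "nat set \<Rightarrow> nat \<Rightarrow> nat set" where
  "shift_back E n = {m. m + n \<in> E}"

end

theory Submission
  imports Defs "HOL-Real_Asymp.Real_Asymp"
begin

text \<open>
  The set \<open>E\<close> records the visits to \<open>A\<close> along a concatenation of finite orbit segments. Let the
  \<open>d\<close>-th segment be \<open>x\<^sub>d, T x\<^sub>d, \<dots>, T\<^sup>d x\<^sub>d\<close>, and for a finite set \<open>F\<close> of times let \<open>p\<^sub>F\<close> be the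
  measure of the set of points that visit \<open>A\<close> at all times in \<open>F\<close>. By invariance, the number of
  visits to that set along a segment of length \<open>d + 1\<close> has mean \<open>(d + 1) p\<^sub>F\<close>, whichever ergodic
  components the measure has. So only the starting points \<open>x\<^sub>d\<close> have to be chosen such that the
  deviations from the mean cancel, for all \<open>F\<close> simultaneously.

  The cancellation comes from a greedy choice (\<open>greedy_sampling\<close>), a deterministic substitute for
  the strong law of large numbers. Let \<open>s\<^sub>F\<close> be the deviation accumulated so far. Some weighted sum
  \<open>\<Sum>\<^sub>F c\<^sub>F s\<^sub>F\<^sup>2\<close> serves as an energy. The cross term that a new point contributes to the energy has
  mean zero, so some point makes it nonpositive, and the energy grows by no more than the square of
  the length of the segment. After \<open>K\<close> segments each \<open>s\<^sub>F\<close> is therefore \<open>O(K\<^sup>3\<^sup>/\<^sup>2)\<close>.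

  The concatenation differs from the separate orbits in two ways: a window \<open>m + F\<close> can stick out
  of its segment, which spoils at most \<open>Max F\<close> places in each segment (\<open>concatenated_window_error\<close>),
  and the last segment may be incomplete (\<open>averages_tendsto_zero_of_triangle\<close>). Both errors are
  \<open>O(K)\<close>, while the total length of \<open>K\<close> segments is about \<open>K\<^sup>2 / 2\<close>. This is why the lengths grow
  linearly: they tend to infinity, yet each segment is short compared with all those before it.
\<close>

section \<open>Greedy sampling\<close>

lemma (in prob_space) exists_nonpos_of_expectation_zero:
  fixes f :: "'a \<Rightarrow> real"
  assumes "integrable M f" and "expectation f = 0"
  shows "\<exists>x\<in>space M. f x \<le> 0"
proof (rule ccontr)
  assume "\<not> (\<exists>x\<in>space M. f x \<le> 0)"
  then have pos: "f x > 0" if "x \<in> space M" for x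
    using that by force
  then have "AE x in M. 0 \<le> f x"
    by (intro AE_I2) (simp add: less_imp_le)
  then have "AE x in M. f x = 0"
    using assms integral_nonneg_eq_0_iff_AE by blast
  then have "AE x in M. False"
  proof (rule AE_mp, intro AE_I2 impI)
    show False if "x \<in> space M" and "f x = 0" for x
      using pos that by force
  qed
  then show False
    by simp
qed

lemma summable_half_power_mult_bounded:
  fixes u :: "nat \<Rightarrow> real"
  assumes "\<And>j. \<bar>u j\<bar> \<le> B"
  shows "summable (\<lambda>j. (1/2)^Suc j * u j)"
proof (rule summable_comparison_test')
  show "summable (\<lambda>j. (1/2)^Suc j * B)"
    using power_half_series[THEN sums_summable] by (rule summable_mult2)
  show "norm ((1/2)^Suc j * u j) \<le> (1/2)^Suc j * B" for j
    using assms[of j] by (simp add: abs_mult)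
qed

lemma suminf_half_power_mult_le:
  fixes u :: "nat \<Rightarrow> real"
  assumes "\<And>j. \<bar>u j\<bar> \<le> B"
  shows "(\<Sum>j. (1/2)^Suc j * u j) \<le> B"
proof -
  have *: "(\<lambda>j. (1/2)^Suc j * B) sums (1 * B)"
    by (rule sums_mult2[OF power_half_series])
  have "(\<Sum>j. (1/2)^Suc j * u j) \<le> (\<Sum>j. (1/2)^Suc j * B)"
  proof (rule suminf_le)
    show "(1/2)^Suc j * u j \<le> (1/2)^Suc j * B" for j
      using assms[of j] by (intro mult_left_mono) auto
  qed (use summable_half_power_mult_bounded[OF assms] sums_summable[OF *] in auto)
  also have "\<dots> = B"
    using sums_unique[OF *] by simp
  finally show ?thesis .
qed

text \<open>
  One step of the greedy choice. Expanding \<open>(s j + g j x)\<^sup>2\<close>, the weighted sum of the cross terms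
  \<open>s j * g j x\<close> is an integrable function of \<open>x\<close> with mean zero, hence nonpositive somewhere. The
  weights \<open>(1/2)^Suc j\<close> have total mass 1, so the squares \<open>(g j x)\<^sup>2\<close> add no more than \<open>b\<^sup>2\<close>.
\<close>

lemma (in prob_space) greedy_step:
  fixes g :: "nat \<Rightarrow> 'a \<Rightarrow> real" and s :: "nat \<Rightarrow> real"
  assumes meas: "\<And>j. g j \<in> borel_measurable M"
    and mean: "\<And>j. expectation (g j) = 0"
    and bound: "\<And>j x. x \<in> space M \<Longrightarrow> \<bar>g j x\<bar> \<le> b"
    and s: "\<And>j. \<bar>s j\<bar> \<le> B"
  shows "\<exists>x\<in>space M. (\<Sum>j. (1/2)^Suc j * (s j + g j x)\<^sup>2) \<le> (\<Sum>j. (1/2)^Suc j * (s j)\<^sup>2) + b\<^sup>2"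
proof -
  have int_g: "integrable M (g j)" for j
    using meas bound by (intro integrable_const_bound[where B = b]) auto
  have cross: "\<bar>s j * g j x\<bar> \<le> B * b" if "x \<in> space M" for j x
    using mult_mono'[OF s[of j] bound[OF that, of j]] by (simp add: abs_mult)
  define \<Phi> where "\<Phi> x = (\<Sum>j. (1/2)^Suc j * (s j * g j x))" for x
  have int: "integrable M (\<lambda>x. (1/2)^Suc j * (s j * g j x))" for j
    using int_g by simp
  have sum1: "AE x in M. summable (\<lambda>j. norm ((1/2)^Suc j * (s j * g j x)))"
  proof (rule AE_I2)
    fix x assume "x \<in> space M"
    then show "summable (\<lambda>j. norm ((1/2)^Suc j * (s j * g j x)))"
      using summable_half_power_mult_bounded[of "\<lambda>j. \<bar>s j * g j x\<bar>" "B * b"] cross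
      by (simp add: abs_mult)
  qed
  have sum2: "summable (\<lambda>j. \<integral>x. norm ((1/2)^Suc j * (s j * g j x)) \<partial>M)"
  proof -
    have "(\<integral>x. \<bar>s j * g j x\<bar> \<partial>M) \<le> B * b" for j
    proof (rule integral_le_const)
      show "integrable M (\<lambda>x. \<bar>s j * g j x\<bar>)"
        using int_g by simp
      show "AE x in M. \<bar>s j * g j x\<bar> \<le> B * b"
        using cross by (rule AE_I2)
    qed
    moreover have "0 \<le> (\<integral>x. \<bar>s j * g j x\<bar> \<partial>M)" for j
      by (rule integral_nonneg_AE) simp
    ultimately have "summable (\<lambda>j. (1/2)^Suc j * (\<integral>x. \<bar>s j * g j x\<bar> \<partial>M))"
      by (intro summable_half_power_mult_bounded) (simp add: abs_of_nonneg)
    then show ?thesis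
      by (simp add: abs_mult mult.assoc)
  qed
  have "integrable M \<Phi>"
    unfolding \<Phi>_def by (rule integrable_suminf[OF int sum1 sum2])
  moreover have "expectation \<Phi> = 0"
    unfolding \<Phi>_def using integral_suminf[OF int sum1 sum2] by (simp add: mean)
  ultimately obtain x where x: "x \<in> space M" and "\<Phi> x \<le> 0"
    using exists_nonpos_of_expectation_zero by blast
  have sq: "\<bar>(s j)\<^sup>2\<bar> \<le> B\<^sup>2" "\<bar>(g j x)\<^sup>2\<bar> \<le> b\<^sup>2" for j
    using power_mono[OF s[of j], of 2] power_mono[OF bound[OF x, of j], of 2] by simp_all
  note summables = summable_half_power_mult_bounded[of "\<lambda>j. (s j)\<^sup>2", OF sq(1)]
    summable_half_power_mult_bounded[of "\<lambda>j. s j * g j x", OF cross[OF x]]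
    summable_half_power_mult_bounded[of "\<lambda>j. (g j x)\<^sup>2", OF sq(2)]
  have "(\<lambda>j. (1/2)^Suc j * (s j)\<^sup>2 + 2 * ((1/2)^Suc j * (s j * g j x)) + (1/2)^Suc j * (g j x)\<^sup>2) sums
      ((\<Sum>j. (1/2)^Suc j * (s j)\<^sup>2) + 2 * \<Phi> x + (\<Sum>j. (1/2)^Suc j * (g j x)\<^sup>2))"
    unfolding \<Phi>_def by (intro sums_add sums_mult summable_sums summables)
  moreover have "(1/2)^Suc j * (s j)\<^sup>2 + 2 * ((1/2)^Suc j * (s j * g j x)) + (1/2)^Suc j * (g j x)\<^sup>2
      = (1/2)^Suc j * (s j + g j x)\<^sup>2" for j
    by (simp add: power2_eq_square field_simps)
  ultimately have "(\<Sum>j. (1/2)^Suc j * (s j + g j x)\<^sup>2) =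
      (\<Sum>j. (1/2)^Suc j * (s j)\<^sup>2) + 2 * \<Phi> x + (\<Sum>j. (1/2)^Suc j * (g j x)\<^sup>2)"
    by (simp only: sums_iff)
  also have "\<dots> \<le> (\<Sum>j. (1/2)^Suc j * (s j)\<^sup>2) + b\<^sup>2"
    using \<open>\<Phi> x \<le> 0\<close> suminf_half_power_mult_le[of "\<lambda>j. (g j x)\<^sup>2", OF sq(2)] by simp
  finally show ?thesis
    using x by blast
qed

text \<open>
  Iterating \<open>greedy_step\<close> bounds the energy after \<open>K\<close> steps by \<open>\<Sum>k<K. (b k)\<^sup>2\<close>, and a single
  accumulated sum has weight \<open>(1/2)^Suc j\<close> in it. The bound has the size that independent samples
  would give with high probability, but it holds for all indices \<open>j\<close> and all \<open>K\<close> at once.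
\<close>

lemma (in prob_space) greedy_sampling:
  fixes g :: "nat \<Rightarrow> nat \<Rightarrow> 'a \<Rightarrow> real" and b :: "nat \<Rightarrow> real"
  assumes meas: "\<And>j k. g j k \<in> borel_measurable M"
    and mean: "\<And>j k. expectation (g j k) = 0"
    and bound: "\<And>j k x. x \<in> space M \<Longrightarrow> \<bar>g j k x\<bar> \<le> b k"
  shows "\<exists>x :: nat \<Rightarrow> 'a. range x \<subseteq> space M \<and>
    (\<forall>j K. (\<Sum>k<K. g j k (x k))\<^sup>2 \<le> 2 ^ Suc j * (\<Sum>k<K. (b k)\<^sup>2))"
proof -
  define P where "P K s \<longleftrightarrow> (\<exists>B. \<forall>j. \<bar>s j\<bar> \<le> B) \<and>
    (\<Sum>j. (1/2)^Suc j * (s j)\<^sup>2) \<le> (\<Sum>k<K. (b k)\<^sup>2)" for K and s :: "nat \<Rightarrow> real"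
  define Q where "Q K s s' \<longleftrightarrow> (\<exists>x\<in>space M. \<forall>j. s' j = s j + g j K x)"
    for K and s s' :: "nat \<Rightarrow> real"
  \<comment> \<open>Dependent choice yields some initial state with the required property, so the condition
    that it be zero has to be part of that property.\<close>
  have "\<exists>S. \<forall>K. (P K (S K) \<and> (K = 0 \<longrightarrow> S K = (\<lambda>_. 0))) \<and> Q K (S K) (S (Suc K))"
  proof (rule dependent_nat_choice)
    show "\<exists>s. P 0 s \<and> (0 = 0 \<longrightarrow> s = (\<lambda>_. 0))" for K :: nat
      by (auto simp: P_def)
  next
    fix s K
    assume "P K s \<and> (K = 0 \<longrightarrow> s = (\<lambda>_. 0))"
    then obtain B where B: "\<And>j. \<bar>s j\<bar> \<le> B"
      and V: "(\<Sum>j. (1/2)^Suc j * (s j)\<^sup>2) \<le> (\<Sum>k<K. (b k)\<^sup>2)"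
      unfolding P_def by blast
    obtain x where x: "x \<in> space M"
      and le: "(\<Sum>j. (1/2)^Suc j * (s j + g j K x)\<^sup>2) \<le> (\<Sum>j. (1/2)^Suc j * (s j)\<^sup>2) + (b K)\<^sup>2"
      using greedy_step[of "\<lambda>j. g j K" "b K" s B] meas mean bound B by blast
    have "\<bar>s j + g j K x\<bar> \<le> B + b K" for j
      using B[of j] bound[OF x, of j K] by linarith
    then have "P (Suc K) (\<lambda>j. s j + g j K x)"
      using V le unfolding P_def by auto
    then show "\<exists>s'. (P (Suc K) s' \<and> (Suc K = 0 \<longrightarrow> s' = (\<lambda>_. 0))) \<and> Q K s s'"
      using x unfolding Q_def by auto
  qed
  then obtain S where P: "\<And>K. P K (S K)" and S0: "S 0 = (\<lambda>_. 0)" and Q: "\<And>K. Q K (S K) (S (Suc K))"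
    by blast
  from Q obtain x where x: "\<And>K. x K \<in> space M"
    and step: "\<And>K j. S (Suc K) j = S K j + g j K (x K)"
    unfolding Q_def by metis
  have S: "S K j = (\<Sum>k<K. g j k (x k))" for K j
    by (induction K) (simp_all add: S0 step)
  have "(\<Sum>k<K. g j k (x k))\<^sup>2 \<le> 2 ^ Suc j * (\<Sum>k<K. (b k)\<^sup>2)" for j K
  proof -
    obtain B where B: "\<And>j. \<bar>S K j\<bar> \<le> B"
      using P[of K] unfolding P_def by blast
    have "\<bar>(S K j)\<^sup>2\<bar> \<le> B\<^sup>2" for j
      using power_mono[OF B[of j], of 2] by simp
    then have "summable (\<lambda>j. (1/2)^Suc j * (S K j)\<^sup>2)"
      by (rule summable_half_power_mult_bounded)
    then have "(\<Sum>i\<in>{j}. (1/2)^Suc i * (S K i)\<^sup>2) \<le> (\<Sum>i. (1/2)^Suc i * (S K i)\<^sup>2)"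
      by (rule sum_le_suminf) auto
    also have "\<dots> \<le> (\<Sum>k<K. (b k)\<^sup>2)"
      using P[of K] unfolding P_def by blast
    finally show ?thesis
      by (simp add: S[symmetric] field_simps power_one_over)
  qed
  then show ?thesis
    using x by blast
qed

section \<open>Visits along orbits\<close>

definition visit_pattern :: "'a measure \<Rightarrow> ('a \<Rightarrow> 'a) \<Rightarrow> 'a set \<Rightarrow> nat set \<Rightarrow> 'a set" where
  "visit_pattern M T A F = {x \<in> space M. \<forall>f\<in>F. (T ^^ f) x \<in> A}"

context measure_preserving_system
begin

lemma measurable_funpow_T [measurable]: "T ^^ i \<in> measurable M M"
  using measurable_T by (induction i) (auto simp: id_def)

lemma measure_vimage_funpow:
  assumes "B \<in> sets M"
  shows "prob ((T ^^ i) -` B \<inter> space M) = prob B"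
proof (induction i)
  case (Suc i)
  have "(T ^^ Suc i) -` B \<inter> space M = T -` ((T ^^ i) -` B \<inter> space M) \<inter> space M"
    using measurable_space[OF measurable_T] by (auto simp: funpow_swap1)
  moreover have "(T ^^ i) -` B \<inter> space M \<in> sets M"
    using measurable_funpow_T assms by (rule measurable_sets)
  ultimately show ?case
    using measure_vimage Suc.IH by metis
qed (use sets.sets_into_space[OF assms] in \<open>simp add: Int_absorb2\<close>)

lemma sets_visit_pattern:
  assumes [measurable]: "A \<in> sets M" and "finite F"
  shows "visit_pattern M T A F \<in> sets M"
  unfolding visit_pattern_def using \<open>finite F\<close> by measurable

lemma expectation_visits:
  assumes "B \<in> sets M"
  shows "expectation (\<lambda>x. \<Sum>i\<le>d. indicator B ((T ^^ i) x) - prob B) = 0"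
proof -
  note [measurable] = assms
  have int: "integrable M (\<lambda>x. indicator B ((T ^^ i) x) :: real)" for i
    by (rule integrable_const_bound[where B = 1]) (auto simp: indicator_def)
  have "expectation (\<lambda>x. indicator B ((T ^^ i) x)) = prob B" for i
  proof -
    have "expectation (\<lambda>x. indicator B ((T ^^ i) x)) =
        expectation (indicat_real ((T ^^ i) -` B \<inter> space M))"
      by (rule Bochner_Integration.integral_cong) (auto simp: indicator_def)
    then show ?thesis
      by (simp add: measure_vimage_funpow[OF assms] Int_assoc)
  qed
  then show ?thesis
    using int by (simp add: prob_space)
qed

end

section \<open>Concatenating orbit segments\<close>

text \<open>
  Segment \<open>d\<close> occupies the places \<open>triangle d + i\<close> with \<open>i \<le> d\<close>. These are the values
  \<open>prod_encode (i, d - i)\<close> of the diagonal enumeration of pairs, so decoding a place yields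
  its offset \<open>i\<close> and the number \<open>i + j\<close> of its segment.
\<close>

definition concatenated_visits :: "('a \<Rightarrow> 'a) \<Rightarrow> 'a set \<Rightarrow> (nat \<Rightarrow> 'a) \<Rightarrow> nat set" where
  "concatenated_visits T A x = {m. case prod_decode m of (i, j) \<Rightarrow> (T ^^ i) (x (i + j)) \<in> A}"

lemma prod_encode_in_segment: "i \<le> d \<Longrightarrow> prod_encode (i, d - i) = triangle d + i"
  by (simp add: prod_encode_def)

lemma triangle_add_mem_concatenated_visits:
  assumes "i \<le> d"
  shows "triangle d + i \<in> concatenated_visits T A x \<longleftrightarrow> (T ^^ i) (x d) \<in> A"
  using assms by (simp add: concatenated_visits_def flip: prod_encode_in_segment)

lemma ex_segment: "\<exists>d i. i \<le> d \<and> m = triangle d + i"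
proof -
  obtain i j where "m = prod_encode (i, j)"
    by (metis prod_decode_inverse surj_pair)
  then show ?thesis
    by (intro exI[of _ "i + j"] exI[of _ i]) (simp add: prod_encode_def)
qed

lemma sum_lessThan_triangle:
  fixes \<phi> :: "nat \<Rightarrow> 'b::comm_monoid_add"
  shows "(\<Sum>m<triangle K. \<phi> m) = (\<Sum>d<K. \<Sum>i\<le>d. \<phi> (triangle d + i))"
proof (induction K)
  case (Suc K)
  have "(\<Sum>m<triangle K + l. \<phi> m) = (\<Sum>m<triangle K. \<phi> m) + (\<Sum>i<l. \<phi> (triangle K + i))" for l
    by (induction l) (simp_all add: add.assoc)
  from this[of "Suc K", unfolded lessThan_Suc_atMost[of K]] show ?case
    by (simp only: triangle_Suc sum.lessThan_Suc Suc)
qed simp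

lemma real_triangle: "real (triangle d) = real d * (real d + 1) / 2"
  by (induction d) (simp_all add: field_simps)

text \<open>
  If \<open>N\<close> lies in segment \<open>d\<close>, the incomplete segment adds at most \<open>d\<close> to the sum up to
  \<open>triangle d\<close>, while \<open>d\<^sup>2 / 2 \<le> N \<le> 3 d\<^sup>2\<close>. The average is therefore of order \<open>1 / sqrt d\<close>, which
  is the order of the fourth root of \<open>1 / N\<close>.
\<close>

lemma averages_tendsto_zero_of_triangle:
  fixes e :: "nat \<Rightarrow> real"
  assumes e: "\<And>m. \<bar>e m\<bar> \<le> 1"
    and K: "\<And>K. \<bar>\<Sum>m<triangle K. e m\<bar> \<le> C * (real K * sqrt K)"
  shows "(\<lambda>N. (\<Sum>m<N. e m) / real N) \<longlonglongrightarrow> 0"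
proof (rule Lim_null_comparison)
  have "C \<ge> 0"
    using K[of 1] by (simp add: order_trans[OF abs_ge_zero])
  show "eventually (\<lambda>N. norm ((\<Sum>m<N. e m) / real N) \<le> 2 * (C + 2) / sqrt (sqrt (real N / 3))) sequentially"
    using eventually_gt_at_top[of 0]
  proof eventually_elim
    case (elim N)
    obtain d i where i: "i \<le> d" and N: "N = triangle d + i"
      using ex_segment by blast
    have "d > 0"
      using elim i N by (cases d) auto
    then have d: "real d \<ge> 1" "sqrt (real d) \<ge> 1"
      by simp_all
    have "(\<Sum>m<N. e m) = (\<Sum>m<triangle d. e m) + (\<Sum>m\<in>{triangle d..<N}. e m)"
      using N by (simp add: lessThan_atLeast0 sum.atLeastLessThan_concat)
    moreover have "\<bar>\<Sum>m\<in>{triangle d..<N}. e m\<bar> \<le> (\<Sum>m\<in>{triangle d..<N}. 1)"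
      by (rule order_trans[OF sum_abs sum_mono]) (rule e)
    ultimately have "\<bar>\<Sum>m<N. e m\<bar> \<le> C * (real d * sqrt d) + real d"
      using K[of d] i N by simp
    also have "\<dots> \<le> (C + 2) * (real d * sqrt d)"
      using mult_mono[OF order_refl[of "real d"] d(2)] by (simp add: distrib_right)
    finally have num: "\<bar>\<Sum>m<N. e m\<bar> \<le> (C + 2) * (real d * sqrt d)" .
    have N_ge: "real d * real d / 2 \<le> real N"
      using N by (simp add: real_triangle field_simps)
    have "real d * real d \<ge> real d"
      using mult_left_mono[OF d(1), of "real d"] by simp
    moreover have "real N * 2 = real d * real d + real d + real i * 2"
      using N by (simp add: real_triangle field_simps)
    moreover have "real i \<le> real d"
      using i by simp
    ultimately have "real N \<le> 3 * (real d * real d)"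
      using d(1) by argo
    then have "sqrt (real N / 3) \<le> real d"
      by (intro real_le_lsqrt) (auto simp: power2_eq_square)
    then have root: "sqrt (sqrt (real N / 3)) \<le> sqrt d"
      by simp
    have "norm ((\<Sum>m<N. e m) / real N) = \<bar>\<Sum>m<N. e m\<bar> / real N"
      by simp
    also have "\<dots> \<le> ((C + 2) * (real d * sqrt d)) / (real d * real d / 2)"
      by (rule frac_le[OF _ num _ N_ge]) (use d \<open>C \<ge> 0\<close> in simp_all)
    also have "\<dots> = 2 * (C + 2) * (sqrt d / real d)"
      using d by (simp add: field_simps)
    also have "sqrt d / real d = 1 / sqrt d"
      using d by (simp add: real_div_sqrt field_simps)
    also have "2 * (C + 2) * (1 / sqrt d) \<le> 2 * (C + 2) / sqrt (sqrt (real N / 3))"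
      using root elim \<open>C \<ge> 0\<close> by (auto intro!: frac_le)
    finally show ?case .
  qed
  show "(\<lambda>N. 2 * (C + 2) / sqrt (sqrt (real N / 3))) \<longlonglongrightarrow> 0"
    by real_asymp
qed

text \<open>
  If a window reaches at most \<open>r\<close> places ahead, then membership of \<open>triangle d + i\<close> in the
  intersection of shifts is decided by the orbit of \<open>x d\<close> alone, except at the last \<open>r\<close> offsets.
\<close>

lemma concatenated_window_error:
  assumes x: "\<And>i. (T ^^ i) (x d) \<in> space M" and F: "\<And>f. f \<in> F \<Longrightarrow> f \<le> r"
  shows "(\<Sum>i\<le>d. \<bar>indicator (\<Inter>f\<in>F. shift_back (concatenated_visits T A x) f) (triangle d + i)
      - indicator (visit_pattern M T A F) ((T ^^ i) (x d))\<bar>) \<le> real r"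
    (is "(\<Sum>i\<le>d. \<bar>?D i - ?H i\<bar>) \<le> _")
proof -
  have "\<bar>?D i - ?H i\<bar> \<le> indicator {Suc d - r..d} i" if "i \<le> d" for i
  proof (cases "i + r \<le> d")
    case True
    have "triangle d + i + f \<in> concatenated_visits T A x \<longleftrightarrow> (T ^^ f) ((T ^^ i) (x d)) \<in> A"
      if "f \<in> F" for f
    proof -
      have "i + f \<le> d"
        using True F[OF that] by simp
      then have "triangle d + (i + f) \<in> concatenated_visits T A x \<longleftrightarrow> (T ^^ (f + i)) (x d) \<in> A"
        by (simp only: triangle_add_mem_concatenated_visits add.commute[of f i])
      then show ?thesis
        by (simp add: add.assoc funpow_add)
    qed
    then have "?D i = ?H i"
      using x by (auto simp: indicator_def shift_back_def visit_pattern_def)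
    then show ?thesis
      by simp
  next
    case False
    then show ?thesis
      using that by (auto simp: indicator_def)
  qed
  then have "(\<Sum>i\<le>d. \<bar>?D i - ?H i\<bar>) \<le> (\<Sum>i\<le>d. indicator {Suc d - r..d} i)"
    by (intro sum_mono) simp
  also have "\<dots> = (\<Sum>i\<in>{Suc d - r..d}. 1)"
    by (rule sum.mono_neutral_cong_right) (auto simp: indicator_def)
  also have "\<dots> \<le> real r"
    by simp
  finally show ?thesis .
qed

text \<open>
  The window errors, at most \<open>r\<close> for each of \<open>K\<close> segments, are absorbed into the bound of order
  \<open>K * sqrt K\<close> for the deviations along the separate orbits.
\<close>

lemma averages_concatenated_visits:
  fixes x :: "nat \<Rightarrow> 'a"
  assumes x: "\<And>i d. (T ^^ i) (x d) \<in> space M" and "finite F" and p: "0 \<le> p" "p \<le> 1"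
    and dev: "\<And>K. \<bar>\<Sum>d<K. \<Sum>i\<le>d. indicator (visit_pattern M T A F) ((T ^^ i) (x d)) - p\<bar>
      \<le> C * (real K * sqrt K)"
  shows "(\<lambda>N. real (card ((\<Inter>f\<in>F. shift_back (concatenated_visits T A x) f) \<inter> {0..<N})) / real N)
    \<longlonglongrightarrow> p"
proof -
  define D where "D = (\<Inter>f\<in>F. shift_back (concatenated_visits T A x) f)"
  define H where "H = visit_pattern M T A F"
  define r where "r = Max (insert 0 F)"
  have r: "f \<le> r" if "f \<in> F" for f
    unfolding r_def using \<open>finite F\<close> that by simp
  have "(\<lambda>N. (\<Sum>m<N. indicator D m - p) / real N) \<longlonglongrightarrow> 0"
  proof (rule averages_tendsto_zero_of_triangle)
    show "\<bar>indicator D m - p\<bar> \<le> 1" for m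
      using p by (auto simp: indicator_def)
    fix K
    define b where "b d i = indicator H ((T ^^ i) (x d)) - p" for d i
    have "(\<Sum>m<triangle K. indicator D m - p) - (\<Sum>d<K. \<Sum>i\<le>d. b d i) =
        (\<Sum>d<K. \<Sum>i\<le>d. indicator D (triangle d + i) - indicator H ((T ^^ i) (x d)))"
      unfolding sum_lessThan_triangle b_def by (simp add: sum_subtractf[symmetric])
    also have "\<bar>\<dots>\<bar> \<le> (\<Sum>d<K. real r)"
      by (rule order_trans[OF sum_abs sum_mono], rule order_trans[OF sum_abs])
        (unfold D_def H_def, rule concatenated_window_error[OF x r])
    finally have "\<bar>\<Sum>m<triangle K. indicator D m - p\<bar> \<le> C * (real K * sqrt K) + real K * real r"
      using dev[of K] unfolding b_def H_def by simp
    moreover have "real K \<le> real K * sqrt K"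
      by (cases K) (auto intro: mult_left_mono[of 1, simplified])
    then have "real K * real r \<le> (real K * sqrt K) * real r"
      by (rule mult_right_mono) simp
    ultimately show "\<bar>\<Sum>m<triangle K. indicator D m - p\<bar> \<le> (C + real r) * (real K * sqrt K)"
      by (simp add: algebra_simps)
  qed
  then have "(\<lambda>N. (\<Sum>m<N. indicator D m - p) / real N + p) \<longlonglongrightarrow> 0 + p"
    by (intro tendsto_intros)
  moreover have "eventually (\<lambda>N. (\<Sum>m<N. indicator D m - p) / real N + p =
      real (card (D \<inter> {0..<N})) / real N) sequentially"
    using eventually_gt_at_top[of 0]
  proof eventually_elim
    case (elim N)
    have "(\<Sum>m<N. indicator D m) = real (card (D \<inter> {0..<N}))"
      by (simp add: indicator_def sum.If_cases lessThan_atLeast0 Int_commute Collect_mem_eq)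
    then show ?case
      using elim by (simp add: sum_subtractf field_simps)
  qed
  ultimately have "(\<lambda>N. real (card (D \<inter> {0..<N})) / real N) \<longlonglongrightarrow> 0 + p"
    by (rule Lim_transform_eventually)
  then show ?thesis
    unfolding D_def by simp
qed

section \<open>Every measurable set has a set of naturals with its correlations\<close>

text \<open>
  Finite sets of times are enumerated by \<open>set_decode\<close>. With segments of length \<open>d + 1\<close> the energy
  bound of \<open>greedy_sampling\<close> is \<open>\<Sum>d<K. (d + 1)\<^sup>2 \<le> K\<^sup>3\<close>.
\<close>

lemma (in measure_preserving_system) exists_set_with_correlations:
  assumes A: "A \<in> sets M"
  shows "\<exists>E. \<forall>F. finite F \<longrightarrow>
    (\<lambda>N. real (card ((\<Inter>f\<in>F. shift_back E f) \<inter> {0..<N})) / real N) \<longlonglongrightarrow> prob (visit_pattern M T A F)"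
proof -
  define H where "H j = visit_pattern M T A (set_decode j)" for j
  define g where "g j d y = (\<Sum>i\<le>d. indicator (H j) ((T ^^ i) y) - prob (H j))" for j d y
  have [measurable]: "H j \<in> sets M" for j
    unfolding H_def by (rule sets_visit_pattern[OF A finite_set_decode])
  have g_bound: "\<bar>g j d y\<bar> \<le> real (Suc d)" for j d y
  proof -
    have "\<bar>g j d y\<bar> \<le> (\<Sum>i\<le>d. 1)"
      unfolding g_def using prob_le_1[of "H j"]
      by (intro order_trans[OF sum_abs sum_mono]) (auto simp: indicator_def)
    then show ?thesis
      by simp
  qed
  have "\<exists>x. range x \<subseteq> space M \<and>
      (\<forall>j K. (\<Sum>d<K. g j d (x d))\<^sup>2 \<le> 2 ^ Suc j * (\<Sum>d<K. (real (Suc d))\<^sup>2))"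
  proof (rule greedy_sampling)
    show "g j d \<in> borel_measurable M" for j d
      unfolding g_def by measurable
    show "expectation (g j d) = 0" for j d
      unfolding g_def by (rule expectation_visits) simp
  qed (rule g_bound)
  then obtain x where x: "\<And>d. x d \<in> space M"
    and energy: "\<And>j K. (\<Sum>d<K. g j d (x d))\<^sup>2 \<le> 2 ^ Suc j * (\<Sum>d<K. (real (Suc d))\<^sup>2)"
    by blast
  have dev: "\<bar>\<Sum>d<K. g j d (x d)\<bar> \<le> sqrt (2 ^ Suc j) * (real K * sqrt K)" for j K
  proof -
    have "(\<Sum>d<K. (real (Suc d))\<^sup>2) \<le> (\<Sum>d<K. (real K)\<^sup>2)"
      by (intro sum_mono power_mono) auto
    then have "(\<Sum>d<K. g j d (x d))\<^sup>2 \<le> 2 ^ Suc j * ((real K)\<^sup>2 * real K)"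
      using energy[of j K] by (simp add: order_trans mult.commute)
    then have "\<bar>\<Sum>d<K. g j d (x d)\<bar> \<le> sqrt (2 ^ Suc j * ((real K)\<^sup>2 * real K))"
      by (rule real_le_rsqrt[of "\<bar>_\<bar>", simplified])
    then show ?thesis
      by (simp only: real_sqrt_mult real_sqrt_abs abs_of_nat)
  qed
  show ?thesis
  proof (intro exI[of _ "concatenated_visits T A x"] allI impI)
    fix F :: "nat set" assume "finite F"
    then have F: "set_decode (set_encode F) = F"
      by simp
    show "(\<lambda>N. real (card ((\<Inter>f\<in>F. shift_back (concatenated_visits T A x) f) \<inter> {0..<N})) / real N)
        \<longlonglongrightarrow> prob (visit_pattern M T A F)"
      using x measurable_space[OF measurable_funpow_T] \<open>finite F\<close> dev[of "set_encode F"]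
      by (intro averages_concatenated_visits[where M = M and C = "sqrt (2 ^ Suc (set_encode F))"]) (simp_all add: g_def H_def F)
  qed
qed

theorem theorem1p4:
  fixes M :: "'a measure" and T :: "'a \<Rightarrow> 'a" and A :: "'a set"
  assumes "measure_preserving_system M T"
    and "A \<in> sets M"
  shows "\<exists>E :: nat set. \<forall>(k :: nat) (n :: nat \<Rightarrow> nat).
    (\<lambda>N :: nat. real (card ((\<Inter>i\<in>{1..k}. shift_back E (n i)) \<inter> {0..<N})) / real N)
      \<longlonglongrightarrow> measure M (space M \<inter> (\<Inter>i\<in>{1..k}. (T ^^ n i) -` A \<inter> space M))"
proof -
  interpret measure_preserving_system M T
    by (rule assms(1))
  obtain E where E: "\<And>F. finite F \<Longrightarrow>
    (\<lambda>N. real (card ((\<Inter>f\<in>F. shift_back E f) \<inter> {0..<N})) / real N) \<longlonglongrightarrow> prob (visit_pattern M T A F)"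
    using exists_set_with_correlations[OF assms(2)] by blast
  show ?thesis
  proof (intro exI[of _ E] allI)
    fix k :: nat and n :: "nat \<Rightarrow> nat"
    have "visit_pattern M T A (n ` {1..k}) = space M \<inter> (\<Inter>i\<in>{1..k}. (T ^^ n i) -` A \<inter> space M)"
      by (auto simp: visit_pattern_def)
    then show "(\<lambda>N. real (card ((\<Inter>i\<in>{1..k}. shift_back E (n i)) \<inter> {0..<N})) / real N)
        \<longlonglongrightarrow> prob (space M \<inter> (\<Inter>i\<in>{1..k}. (T ^^ n i) -` A \<inter> space M))"
      using E[of "n ` {1..k}"] by (simp add: image_image)
  qed
qed

end
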